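(* Let $G$ be a compact Hausdorff topological group, and let $X$ be a $G$-connected space with $X^G\ne\emptyset$. If $H$ and $K$ are closed subgroups of $G$ such that $X^H$ is $K$-invariant and $HK'=K'H$ for all closed subgroups $K'$ of $K$, then $$\mathrm{cat}_K(X^H)\le\mathrm{cat}_G(X).$$
   Context: All spaces are Hausdorff. For a $G$-space $X$ and a subgroup $H\le G$, $X^H=\{x\in X: h\cdot x=x\text{ for all }h\in H\}$. A $G$-space $X$ is $G$-connected if $X^H$ is path-connected for every closed subgroup $H$ of $G$. A $G$-homotopy is a $G$-equivariant homotopy ($G$ acting trivially on $[0,1]$). Equivariant LS-category: a $G$-invariant subset $U$ of a $G$-space $X$ is $G$-categorical if the inclusion $U\hookrightarrow X$ is $G$-homotopic to a $G$-map with values in a single orbit. $\mathrm{cat}_G(X)$ is the least positive integer $k$ such that $X$ is covered by $k$ $G$-categorical open subsets ($\infty$ if there is no such $k$). *)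

theory Defs
  imports "HOL-Analysis.Analysis" "HOL-Algebra.Group_Action" "HOL-Library.Extended_Nat"
begin

definition topological_group :: "('g, 'm) monoid_scheme \<Rightarrow> 'g topology \<Rightarrow> bool" where
  "topological_group G T \<longleftrightarrow>
     group G \<and> topspace T = carrier G \<and>
     continuous_map (prod_topology T T) T (\<lambda>(g, h). g \<otimes>\<^bsub>G\<^esub> h) \<and>
     continuous_map T T (\<lambda>g. inv\<^bsub>G\<^esub> g)"

definition closed_subgroup :: "('g, 'm) monoid_scheme \<Rightarrow> 'g topology \<Rightarrow> 'g set \<Rightarrow> bool" where
  "closed_subgroup G T H \<longleftrightarrow> subgroup H G \<and> closedin T H"

definition G_space ::
    "('g, 'm) monoid_scheme \<Rightarrow> 'g topology \<Rightarrow> 'x topology \<Rightarrow> ('g \<Rightarrow> 'x \<Rightarrow> 'x) \<Rightarrow> bool" where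
  "G_space G T X \<phi> \<longleftrightarrow>
     group_action G (topspace X) \<phi> \<and>
     continuous_map (prod_topology T X) X (\<lambda>(g, x). \<phi> g x)"

definition G_invariant :: "('g, 'm) monoid_scheme \<Rightarrow> ('g \<Rightarrow> 'x \<Rightarrow> 'x) \<Rightarrow> 'x set \<Rightarrow> bool" where
  "G_invariant G \<phi> U \<longleftrightarrow> (\<forall>g \<in> carrier G. \<forall>x \<in> U. \<phi> g x \<in> U)"

definition fixed_points :: "'x topology \<Rightarrow> ('g \<Rightarrow> 'x \<Rightarrow> 'x) \<Rightarrow> 'g set \<Rightarrow> 'x set" where
  "fixed_points X \<phi> H = {x \<in> topspace X. \<forall>h \<in> H. \<phi> h x = x}"

definition G_connected ::
    "('g, 'm) monoid_scheme \<Rightarrow> 'g topology \<Rightarrow> 'x topology \<Rightarrow> ('g \<Rightarrow> 'x \<Rightarrow> 'x) \<Rightarrow> bool" where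
  "G_connected G T X \<phi> \<longleftrightarrow>
     (\<forall>H. closed_subgroup G T H \<longrightarrow>
        path_connected_space (subtopology X (fixed_points X \<phi> H)))"

definition equivariant_on ::
    "('g, 'm) monoid_scheme \<Rightarrow> ('g \<Rightarrow> 'x \<Rightarrow> 'x) \<Rightarrow> 'x set \<Rightarrow> ('x \<Rightarrow> 'x) \<Rightarrow> bool" where
  "equivariant_on G \<phi> U f \<longleftrightarrow> (\<forall>g \<in> carrier G. \<forall>x \<in> U. f (\<phi> g x) = \<phi> g (f x))"

text \<open>
  A \<open>G\<close>-homotopy is a homotopy each of whose stages is equivariant, which is the same as
  equivariance of the homotopy itself when \<open>G\<close> acts trivially on the unit interval.  The end
  map \<open>c\<close> is one of the stages, hence a continuous equivariant map from \<open>U\<close> to \<open>X\<close>.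
\<close>

definition G_categorical ::
    "('g, 'm) monoid_scheme \<Rightarrow> 'x topology \<Rightarrow> ('g \<Rightarrow> 'x \<Rightarrow> 'x) \<Rightarrow> 'x set \<Rightarrow> bool" where
  "G_categorical G X \<phi> U \<longleftrightarrow>
     U \<subseteq> topspace X \<and> G_invariant G \<phi> U \<and>
     (\<exists>c. \<exists>x \<in> topspace X.
        homotopic_with (equivariant_on G \<phi> U) (subtopology X U) X id c \<and>
        c ` U \<subseteq> orbit G \<phi> x)"

text \<open>
  The value is \<open>\<infinity>\<close>, the infimum of the empty set, if there is no finite cover.  The topology of
  \<open>G\<close> plays no role here.
\<close>

definition G_cat :: "('g, 'm) monoid_scheme \<Rightarrow> 'x topology \<Rightarrow> ('g \<Rightarrow> 'x \<Rightarrow> 'x) \<Rightarrow> enat" where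
  "G_cat G X \<phi> =
     Inf {enat k | k. 0 < k \<and>
       (\<exists>U :: nat \<Rightarrow> 'x set.
          (\<forall>i < k. openin X (U i) \<and> G_categorical G X \<phi> (U i)) \<and>
          (\<Union>i < k. U i) = topspace X)}"

text \<open>
  The action of a subgroup on an invariant subset \<open>Y\<close>.  The restriction to \<open>Y\<close> is needed because
  \<^const>\<open>group_action\<close> asks for maps that are extensional on the set acted upon.
\<close>

definition restrict_action :: "('g \<Rightarrow> 'x \<Rightarrow> 'x) \<Rightarrow> 'x set \<Rightarrow> 'g \<Rightarrow> 'x \<Rightarrow> 'x" where
  "restrict_action \<phi> Y = (\<lambda>g. restrict (\<phi> g) Y)"

lemma G_space_restrict_action:
  assumes G: "group G" and X: "G_space G T X \<phi>" and K: "subgroup K G"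
    and Y: "Y \<subseteq> topspace X" and inv: "G_invariant (G\<lparr>carrier := K\<rparr>) \<phi> Y"
  shows "G_space (G\<lparr>carrier := K\<rparr>) (subtopology T K) (subtopology X Y) (restrict_action \<phi> Y)"
proof -
  interpret group G by (rule G)
  interpret A: group_action G "topspace X" \<phi> using X by (simp add: G_space_def)
  have top: "topspace (subtopology X Y) = Y" using Y by auto
  have KG: "k \<in> carrier G" if "k \<in> K" for k using that K subgroup.subset by blast
  have clos: "\<phi> k y \<in> Y" if "k \<in> K" "y \<in> Y" for k y
    using inv that by (simp add: G_invariant_def)
  have bij: "restrict (\<phi> k) Y \<in> Bij Y" if k: "k \<in> K" for k
  proof -
    have "inj_on (\<phi> k) Y"
      using A.inj_prop[OF KG[OF k]] Y inj_on_subset by blast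
    moreover have "y \<in> \<phi> k ` Y" if y: "y \<in> Y" for y
    proof -
      have "\<phi> (inv\<^bsub>G\<^esub> k) y \<in> Y" using clos y k K by (simp add: subgroup.m_inv_closed)
      moreover have "\<phi> k (\<phi> (inv\<^bsub>G\<^esub> k) y) = y"
        using A.composition_rule[of y k "inv\<^bsub>G\<^esub> k"] KG[OF k] y Y A.id_eq_one
        by (metis inv_closed r_inv restrict_apply' subsetD)
      ultimately show ?thesis by (metis image_eqI)
    qed
    ultimately have "bij_betw (\<phi> k) Y Y" using clos k by (auto simp: bij_betw_def)
    then show ?thesis by (simp add: Bij_def)
  qed
  have "group_action (G\<lparr>carrier := K\<rparr>) Y (restrict_action \<phi> Y)"
    unfolding group_action_def group_hom_def group_hom_axioms_def
  proof (intro conjI)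
    show "group (G\<lparr>carrier := K\<rparr>)" using K by (simp add: subgroup.subgroup_is_group)
    show "group (BijGroup Y)" by (rule group_BijGroup)
    show "restrict_action \<phi> Y \<in> hom (G\<lparr>carrier := K\<rparr>) (BijGroup Y)"
      using bij clos Y A.composition_rule KG
      by (auto simp: hom_def BijGroup_def restrict_action_def compose_def fun_eq_iff subset_iff)
  qed
  moreover have "continuous_map (prod_topology (subtopology T K) (subtopology X Y))
      (subtopology X Y) (\<lambda>(g, x). restrict_action \<phi> Y g x)"
  proof -
    have "continuous_map (subtopology (prod_topology T X) (K \<times> Y)) X (\<lambda>(g, x). \<phi> g x)"
      using X by (auto simp: G_space_def intro: continuous_map_from_subtopology)
    then have "continuous_map (subtopology (prod_topology T X) (K \<times> Y)) X
        (\<lambda>(g, x). restrict_action \<phi> Y g x)"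
      by (rule continuous_map_eq) (auto simp: restrict_action_def)
    then show ?thesis
      using clos by (auto simp: continuous_map_in_subtopology restrict_action_def subtopology_Times)
  qed
  ultimately show ?thesis unfolding G_space_def top by blast
qed

end

theory Submission
  imports Defs
begin

text \<open>
  Let \<open>x\<^sub>0\<close> be a point fixed by all of \<open>G\<close>.  The idea is that any \<open>G\<close>-categorical set \<open>U\<close> can be
  deformed \<open>G\<close>-equivariantly not just into some orbit \<open>G x\<close> but to the single point \<open>x\<^sub>0\<close>
  (lemma \<open>categorical_contracts_to_fixed_point\<close>).  Indeed \<open>x\<close> and \<open>x\<^sub>0\<close> are both fixed by the
  stabilizer \<open>G\<^sub>x\<close>, a closed subgroup, so \<open>G\<close>-connectedness joins them by a path \<open>\<gamma>\<close> of
  \<open>G\<^sub>x\<close>-fixed points, and translating \<open>\<gamma>\<close> by \<open>G\<close> pulls the whole orbit into \<open>x\<^sub>0\<close>: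
  \<open>(t, g x) \<mapsto> g (\<gamma> t)\<close>.  Compactness of \<open>G\<close> makes this continuous
  (lemma \<open>orbit_contracts_to_fixed_point\<close>).

  An equivariant contraction of \<open>U\<close> to \<open>x\<^sub>0\<close> preserves points fixed by \<open>H\<close>.  It therefore restricts
  to a \<open>K\<close>-equivariant contraction of \<open>U \<inter> X\<^sup>H\<close> inside \<open>X\<^sup>H\<close> to \<open>x\<^sub>0\<close>, which is itself a \<open>K\<close>-orbit
  of \<open>X\<^sup>H\<close> (lemma \<open>categorical_Int_fixed_points\<close>).  Thus intersecting a \<open>G\<close>-categorical cover
  of \<open>X\<close> with \<open>X\<^sup>H\<close> yields a \<open>K\<close>-categorical cover of \<open>X\<^sup>H\<close> with the same number of members.
\<close>

lemma closed_subgroup_stabilizer: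
  assumes "topological_group G T" and X: "G_space G T X \<phi>" and "t1_space X"
    and x: "x \<in> topspace X"
  shows "closed_subgroup G T (stabilizer G \<phi> x)"
proof -
  interpret A: group_action G "topspace X" \<phi> using X by (simp add: G_space_def)
  have T: "topspace T = carrier G" using assms by (simp add: topological_group_def)
  have "continuous_map T (prod_topology T X) (\<lambda>g. (g, x))"
    using x by (simp add: continuous_map_pairedI)
  then have "continuous_map T X ((\<lambda>(g, y). \<phi> g y) \<circ> (\<lambda>g. (g, x)))"
    using X continuous_map_compose unfolding G_space_def by blast
  then have "continuous_map T X (\<lambda>g. \<phi> g x)" by (simp add: o_def)
  moreover have "closedin X {x}" using assms by (simp add: t1_space_closedin_singleton)
  ultimately have "closedin T {g \<in> topspace T. \<phi> g x \<in> {x}}"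
    by (rule closedin_continuous_map_preimage)
  then show ?thesis
    using A.stabilizer_subgroup[OF x] by (simp add: closed_subgroup_def stabilizer_def T)
qed

text \<open>
  If \<open>g x = g' x\<close>, then \<open>g\<close> and \<open>g'\<close> differ by an element of the stabilizer of \<open>x\<close>.  This makes
  \<open>g x \<mapsto> g p\<close> a well-defined map on the orbit of \<open>x\<close>.
\<close>

lemma (in group_action) translate_eq_if_stabilizer_fixes:
  assumes x: "x \<in> E" and p: "p \<in> E" and k_fixes: "\<And>k. k \<in> stabilizer G \<phi> x \<Longrightarrow> \<phi> k p = p"
    and g: "g \<in> carrier G" and g': "g' \<in> carrier G" and eq: "\<phi> g x = \<phi> g' x"
  shows "\<phi> g p = \<phi> g' p"
proof -
  interpret group G using group_hom by (simp add: group_hom_def)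
  let ?k = "inv g \<otimes> g'"
  have inv_act: "\<phi> (inv g) (\<phi> g y) = y" if "y \<in> E" for y
    using composition_rule[OF that, of "inv g" g] g id_eq_one that
    by (metis inv_closed l_inv restrict_apply')
  have "\<phi> ?k x = x"
    using composition_rule[OF x, of "inv g" g'] g g' eq inv_act[OF x] by simp
  then have "\<phi> ?k p = p" using k_fixes g g' by (simp add: stabilizer_def)
  moreover have "g' = g \<otimes> ?k" using g g' by (simp add: m_assoc[symmetric])
  ultimately show ?thesis using composition_rule[OF p, of g ?k] g g' by simp
qed

text \<open>
  The stages \<open>g x \<mapsto> g (\<gamma> t)\<close> are transported from the group: \<open>[0,1] \<times> G \<rightarrow> [0,1] \<times> G x\<close> is a
  continuous surjection from a compact space onto a Hausdorff space, hence a quotient map, and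
  \<open>(t, g) \<mapsto> g (\<gamma> t)\<close> is plainly continuous upstairs.
\<close>

lemma orbit_contracts_to_fixed_point:
  assumes G: "topological_group G T" and cpt: "compact_space T"
    and X: "G_space G T X \<phi>" and haus: "Hausdorff_space X"
    and conn: "G_connected G T X \<phi>"
    and x0: "x0 \<in> fixed_points X \<phi> (carrier G)" and x: "x \<in> topspace X"
  shows "homotopic_with (equivariant_on G \<phi> (orbit G \<phi> x))
           (subtopology X (orbit G \<phi> x)) X id (\<lambda>_. x0)"
proof -
  interpret A: group_action G "topspace X" \<phi> using X by (simp add: G_space_def)
  interpret group G using G by (simp add: topological_group_def)
  have T: "topspace T = carrier G" using G by (simp add: topological_group_def)
  let ?O = "orbit G \<phi> x" and ?S = "stabilizer G \<phi> x" and ?I = "top_of_set {0..1::real}"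
  have act: "\<phi> g y \<in> topspace X" if "g \<in> carrier G" "y \<in> topspace X" for g y
    using A.element_image that by blast
  have O: "?O \<subseteq> topspace X" using act x by (auto simp: orbit_def)
  then have topO: "topspace (subtopology X ?O) = ?O" by auto
  have O_inv: "\<phi> g y \<in> ?O" if "g \<in> carrier G" "y \<in> ?O" for g y
    using that A.composition_rule[OF x] unfolding orbit_def
    by (smt (verit, best) m_closed mem_Collect_eq)

  have "x \<in> fixed_points X \<phi> ?S" "x0 \<in> fixed_points X \<phi> ?S"
    using x x0 by (auto simp: fixed_points_def stabilizer_def)
  moreover have "path_connected_space (subtopology X (fixed_points X \<phi> ?S))"
    using conn closed_subgroup_stabilizer[OF G X _ x] haus
    by (simp add: G_connected_def Hausdorff_imp_t1_space)
  ultimately obtain \<gamma> where \<gamma>: "pathin (subtopology X (fixed_points X \<phi> ?S)) \<gamma>"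
    and ends: "\<gamma> 0 = x" "\<gamma> 1 = x0"
    unfolding path_connected_space_def topspace_subtopology
    by (metis (no_types, lifting) IntI fixed_points_def mem_Collect_eq)
  have \<gamma>_cont: "continuous_map ?I X \<gamma>"
    using \<gamma> by (simp add: pathin_def continuous_map_in_subtopology)
  have \<gamma>_fix: "\<gamma> t \<in> fixed_points X \<phi> ?S" if "t \<in> {0..1}" for t
    using \<gamma> that by (auto simp: pathin_def continuous_map_in_subtopology)
  have \<gamma>_top: "\<gamma> t \<in> topspace X" if "t \<in> {0..1}" for t
    using \<gamma>_fix[OF that] by (simp add: fixed_points_def)

  \<comment> \<open>\<open>s\<close> picks representatives and need not be continuous; the values of \<open>h\<close> do not depend on
    the choice, because each \<open>\<gamma> t\<close> is fixed by the stabilizer of \<open>x\<close>.\<close>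
  define s where "s y = (SOME g. g \<in> carrier G \<and> \<phi> g x = y)" for y
  define h where "h = (\<lambda>(t, y). \<phi> (s y) (\<gamma> t))"
  have h: "h (t, \<phi> g x) = \<phi> g (\<gamma> t)" if t: "t \<in> {0..1}" and g: "g \<in> carrier G" for t g
  proof -
    have "s (\<phi> g x) \<in> carrier G \<and> \<phi> (s (\<phi> g x)) x = \<phi> g x"
      unfolding s_def by (rule someI[of _ g]) (simp add: g)
    moreover have "\<phi> k (\<gamma> t) = \<gamma> t" if "k \<in> ?S" for k
      using \<gamma>_fix[OF t] that by (simp add: fixed_points_def)
    ultimately show ?thesis
      unfolding h_def prod.case
      using A.translate_eq_if_stabilizer_fixes[OF x \<gamma>_top[OF t]] g by blast
  qed

  let ?q = "\<lambda>(t, g). (t, \<phi> g x)"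
  have orbit_map: "continuous_map (prod_topology ?I T) X (\<lambda>p. \<phi> (snd p) (f (fst p)))"
    if f: "continuous_map ?I X f" for f
  proof -
    have "continuous_map (prod_topology ?I T) (prod_topology T X) (\<lambda>p. (snd p, f (fst p)))"
      using continuous_map_compose[OF continuous_map_fst f]
      by (intro continuous_map_pairedI continuous_map_snd) (simp add: o_def)
    then have "continuous_map (prod_topology ?I T) X
        ((\<lambda>(g, y). \<phi> g y) \<circ> (\<lambda>p. (snd p, f (fst p))))"
      using X continuous_map_compose unfolding G_space_def by blast
    then show ?thesis by (simp add: o_def)
  qed
  have "quotient_map (prod_topology ?I T) (prod_topology ?I (subtopology X ?O)) ?q"
  proof (rule continuous_imp_quotient_map)
    have "continuous_map (prod_topology ?I T) (subtopology X ?O) (\<lambda>p. \<phi> (snd p) x)"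
      using orbit_map[of "\<lambda>_. x"] x by (auto simp: continuous_map_in_subtopology orbit_def T)
    then show "continuous_map (prod_topology ?I T) (prod_topology ?I (subtopology X ?O)) ?q"
      unfolding case_prod_unfold by (intro continuous_map_pairedI continuous_map_fst)
    show "compact_space (prod_topology ?I T)"
      using cpt by (simp add: compact_space_prod_topology compact_space_subtopology)
    show "Hausdorff_space (prod_topology ?I (subtopology X ?O))"
      using haus by (simp add: Hausdorff_space_prod_topology Hausdorff_space_subtopology)
    show "?q ` topspace (prod_topology ?I T) = topspace (prod_topology ?I (subtopology X ?O))"
      unfolding topspace_prod_topology topO T by (force simp: orbit_def image_iff)
  qed
  moreover have "continuous_map (prod_topology ?I T) X (h \<circ> ?q)"
    by (rule continuous_map_eq[OF orbit_map[OF \<gamma>_cont]]) (auto simp: h T)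
  ultimately have h_cont: "continuous_map (prod_topology ?I (subtopology X ?O)) X h"
    by (metis continuous_compose_quotient_map)

  show ?thesis
  proof (subst homotopic_with)
    show "equivariant_on G \<phi> ?O f = equivariant_on G \<phi> ?O f'"
      if "\<And>y. y \<in> topspace (subtopology X ?O) \<Longrightarrow> f y = f' y" for f f'
      using that O_inv unfolding topO equivariant_on_def by auto
    have "equivariant_on G \<phi> ?O (\<lambda>y. h (t, y))" if t: "t \<in> {0..1}" for t
      unfolding equivariant_on_def
    proof (intro ballI)
      fix g y assume g: "g \<in> carrier G" and "y \<in> ?O"
      then obtain k where k: "k \<in> carrier G" "y = \<phi> k x" by (auto simp: orbit_def)
      have "\<phi> g y = \<phi> (g \<otimes>\<^bsub>G\<^esub> k) x" using A.composition_rule[OF x] g k by simp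
      then show "h (t, \<phi> g y) = \<phi> g (h (t, y))"
        using h[OF t] g k A.composition_rule[OF \<gamma>_top[OF t]] by simp
    qed
    moreover have "h (0, y) = id y \<and> h (1, y) = x0" if y: "y \<in> ?O" for y
      using y h x0 by (auto simp: orbit_def ends fixed_points_def)
    ultimately show "\<exists>h. continuous_map (prod_topology ?I (subtopology X ?O)) X h \<and>
        (\<forall>y \<in> topspace (subtopology X ?O). h (0, y) = id y) \<and>
        (\<forall>y \<in> topspace (subtopology X ?O). h (1, y) = x0) \<and>
        (\<forall>t \<in> {0..1}. equivariant_on G \<phi> ?O (\<lambda>y. h (t, y)))"
      using h_cont topO by blast
  qed
qed

text \<open>
  The contraction of the orbit is run after the deformation of \<open>U\<close> into it, precomposed with the end
  map \<open>c\<close> of that deformation; its stages stay equivariant because \<open>c\<close> is.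
\<close>

lemma categorical_contracts_to_fixed_point:
  assumes "topological_group G T" and "compact_space T"
    and "G_space G T X \<phi>" and "Hausdorff_space X" and "G_connected G T X \<phi>"
    and "x0 \<in> fixed_points X \<phi> (carrier G)" and U: "G_categorical G X \<phi> U"
  shows "homotopic_with (equivariant_on G \<phi> U) (subtopology X U) X id (\<lambda>_. x0)"
proof -
  obtain c x where x: "x \<in> topspace X" and c_orbit: "c ` U \<subseteq> orbit G \<phi> x"
    and c: "homotopic_with (equivariant_on G \<phi> U) (subtopology X U) X id c"
    using U by (auto simp: G_categorical_def)
  have c_equiv: "equivariant_on G \<phi> U c"
    using homotopic_with_imp_property[OF c] by blast
  have "continuous_map (subtopology X U) X c"
    using homotopic_with_imp_continuous_maps[OF c] by blast
  then have "continuous_map (subtopology X U) (subtopology X (orbit G \<phi> x)) c"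
    using c_orbit by (auto simp: continuous_map_in_subtopology)
  with orbit_contracts_to_fixed_point[OF assms(1-6) x]
  have "homotopic_with (equivariant_on G \<phi> U) (subtopology X U) X (id \<circ> c) ((\<lambda>_. x0) \<circ> c)"
  proof (rule homotopic_with_compose_continuous_map_right)
    show "equivariant_on G \<phi> U (f \<circ> c)" if "equivariant_on G \<phi> (orbit G \<phi> x) f" for f
      using that c_equiv c_orbit by (auto simp: equivariant_on_def image_subset_iff)
  qed
  then show ?thesis using homotopic_with_trans[OF c] by (simp add: o_def)
qed

text \<open>
  Every stage of an \<open>H\<close>-equivariant homotopy maps \<open>H\<close>-fixed points to \<open>H\<close>-fixed points, so the
  contraction of \<open>U\<close> can be restricted to \<open>X\<^sup>H\<close> in its domain and codomain simultaneously.
\<close>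

lemma categorical_Int_fixed_points:
  assumes H: "H \<subseteq> carrier G" and K: "subgroup K G"
    and inv: "G_invariant (G\<lparr>carrier := K\<rparr>) \<phi> (fixed_points X \<phi> H)"
    and x0: "x0 \<in> fixed_points X \<phi> (carrier G)"
    and U: "U \<subseteq> topspace X" "G_invariant G \<phi> U"
    and contr: "homotopic_with (equivariant_on G \<phi> U) (subtopology X U) X id (\<lambda>_. x0)"
  shows "G_categorical (G\<lparr>carrier := K\<rparr>) (subtopology X (fixed_points X \<phi> H))
           (restrict_action \<phi> (fixed_points X \<phi> H)) (U \<inter> fixed_points X \<phi> H)"
proof -
  let ?Y = "fixed_points X \<phi> H"
  let ?K = "G\<lparr>carrier := K\<rparr>" and ?\<psi> = "restrict_action \<phi> ?Y" and ?V = "U \<inter> ?Y"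
  have KG: "k \<in> carrier G" if "k \<in> K" for k using K that subgroup.subset by blast
  obtain h where h_cont: "continuous_map (prod_topology (top_of_set {0..1}) (subtopology X U)) X h"
    and h0: "\<And>x. h (0::real, x) = id x" and h1: "\<And>x. h (1, x) = x0"
    and h_equiv: "\<And>t. t \<in> {0..1} \<Longrightarrow> equivariant_on G \<phi> U (\<lambda>x. h (t, x))"
    using contr by (auto simp: homotopic_with_def)
  have h_top: "h (t, x) \<in> topspace X" if "t \<in> {0..1}" "x \<in> U" for t x
    using continuous_map_image_subset_topspace[OF h_cont] U that by (auto simp: image_subset_iff)
  have h_Y: "h (t, x) \<in> ?Y" if t: "t \<in> {0..1}" and x: "x \<in> ?V" for t x
  proof -
    have "\<phi> a (h (t, x)) = h (t, x)" if a: "a \<in> H" for a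
    proof -
      have "h (t, \<phi> a x) = \<phi> a (h (t, x))"
        using h_equiv[OF t] x a H by (simp add: equivariant_on_def subset_iff)
      moreover have "\<phi> a x = x" using x a by (simp add: fixed_points_def)
      ultimately show ?thesis by simp
    qed
    then show ?thesis using h_top t x by (auto simp: fixed_points_def)
  qed
  have "homotopic_with (equivariant_on ?K ?\<psi> ?V) (subtopology (subtopology X ?Y) ?V)
      (subtopology X ?Y) id (\<lambda>_. x0)"
    unfolding homotopic_with_def
  proof (intro exI[of _ h] conjI allI ballI)
    have top: "subtopology (subtopology X ?Y) ?V = subtopology (subtopology X U) ?V"
      by (simp add: subtopology_subtopology Int_ac)
    have "continuous_map (prod_topology (top_of_set {0..1}) (subtopology (subtopology X U) ?V)) X h"
      using continuous_map_from_subtopology[OF h_cont, of "UNIV \<times> ?V"]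
      by (simp add: subtopology_Times)
    then show "continuous_map (prod_topology (top_of_set {0..1})
        (subtopology (subtopology X ?Y) ?V)) (subtopology X ?Y) h"
      unfolding top using h_Y by (auto simp: continuous_map_in_subtopology)
    show "h (0, x) = id x" "h (1, x) = x0" for x using h0 h1 by auto
    show "equivariant_on ?K ?\<psi> ?V (\<lambda>x. h (t, x))" if t: "t \<in> {0..1}" for t
      using h_equiv[OF t] h_Y[OF t] KG
      by (auto simp: equivariant_on_def restrict_action_def)
  qed
  moreover have x0_Y: "x0 \<in> ?Y" using x0 H by (auto simp: fixed_points_def)
  moreover have "x0 \<in> orbit ?K ?\<psi> x0"
  proof -
    have "?\<psi> k x0 = x0" if "k \<in> K" for k
      using x0 x0_Y KG that by (auto simp: restrict_action_def fixed_points_def)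
    moreover have "\<one>\<^bsub>G\<^esub> \<in> K" using K by (rule subgroup.one_closed)
    ultimately show ?thesis by (force simp: orbit_def)
  qed
  moreover have "G_invariant ?K ?\<psi> ?V"
    using inv U KG by (auto simp: G_invariant_def restrict_action_def)
  ultimately show ?thesis
    using U unfolding G_categorical_def
    by (auto simp: fixed_points_def intro!: exI[of _ "\<lambda>_. x0"] bexI[of _ x0])
qed

theorem proposition2p24:
  fixes G :: "('g, 'm) monoid_scheme" and T :: "'g topology"
    and X :: "'x topology" and \<phi> :: "'g \<Rightarrow> 'x \<Rightarrow> 'x"
    and H K :: "'g set"
  assumes "topological_group G T" and "compact_space T" and "Hausdorff_space T"
    and "G_space G T X \<phi>" and "Hausdorff_space X"
    and "G_connected G T X \<phi>"
    and "fixed_points X \<phi> (carrier G) \<noteq> {}"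
    and "closed_subgroup G T H" and "closed_subgroup G T K"
    and "G_invariant (G\<lparr>carrier := K\<rparr>) \<phi> (fixed_points X \<phi> H)"
    and "\<And>K'. closed_subgroup (G\<lparr>carrier := K\<rparr>) (subtopology T K) K' \<Longrightarrow>
           H <#>\<^bsub>G\<^esub> K' = K' <#>\<^bsub>G\<^esub> H"
  shows "G_cat (G\<lparr>carrier := K\<rparr>) (subtopology X (fixed_points X \<phi> H))
            (restrict_action \<phi> (fixed_points X \<phi> H))
         \<le> G_cat G X \<phi>"
proof -
  let ?Y = "fixed_points X \<phi> H"
  let ?K = "G\<lparr>carrier := K\<rparr>" and ?\<psi> = "restrict_action \<phi> ?Y"
  obtain x0 where x0: "x0 \<in> fixed_points X \<phi> (carrier G)" using assms(7) by blast
  have H: "H \<subseteq> carrier G" and K: "subgroup K G"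
    using assms(8,9) by (auto simp: closed_subgroup_def dest: subgroup.subset)
  have categorical: "G_categorical ?K (subtopology X ?Y) ?\<psi> (U \<inter> ?Y)"
    if U: "G_categorical G X \<phi> U" for U
    using categorical_Int_fixed_points[OF H K assms(10) x0 _ _
        categorical_contracts_to_fixed_point[OF assms(1,2,4-6) x0 U]] U
    by (simp add: G_categorical_def)
  have restrict_cover: "(\<forall>i < k. openin (subtopology X ?Y) (U i \<inter> ?Y) \<and>
        G_categorical ?K (subtopology X ?Y) ?\<psi> (U i \<inter> ?Y)) \<and>
      (\<Union>i < k. U i \<inter> ?Y) = topspace (subtopology X ?Y)"
    if U: "\<forall>i < k. openin X (U i) \<and> G_categorical G X \<phi> (U i)"
      and cover: "(\<Union>i < k. U i) = topspace X"
    for k and U :: "nat \<Rightarrow> 'x set"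
  proof -
    have "(\<Union>i < k. U i \<inter> ?Y) = topspace X \<inter> ?Y" unfolding cover[symmetric] by blast
    then show ?thesis using U categorical by (simp add: openin_subtopology_Int)
  qed
  show ?thesis
    unfolding G_cat_def
  proof (intro Inf_superset_mono subsetI, elim CollectE exE conjE)
    fix n k and U :: "nat \<Rightarrow> 'x set"
    assume "n = enat k" "0 < k"
      and "\<forall>i < k. openin X (U i) \<and> G_categorical G X \<phi> (U i)" "(\<Union>i < k. U i) = topspace X"
    with restrict_cover[of k U]
    show "n \<in> {enat k | k. 0 < k \<and>
        (\<exists>V :: nat \<Rightarrow> 'x set.
          (\<forall>i < k. openin (subtopology X ?Y) (V i) \<and>
             G_categorical ?K (subtopology X ?Y) ?\<psi> (V i)) \<and>
          (\<Union>i < k. V i) = topspace (subtopology X ?Y))}"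
      by (intro CollectI exI[of _ k] conjI exI[of _ "\<lambda>i. U i \<inter> ?Y"]) simp_all
  qed
qed

end
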